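(* The finite state model checking problem for mumbling $H_\mu$ (without restricting to a single successor assignment) is undecidable: there is no algorithm that, given a closed mumbling $H_\mu$ hyperproperty formula $\varphi$ and a finite Kripke structure $\mathcal{K}$, decides whether $\mathit{Traces}(\mathcal{K}) \models \varphi$.
   Context: Mumbling $H_\mu$ is a hyperlogic with three formula levels. Trace formulae are $\delta ::= \mathit{ap} \mid Y \mid \delta \lor \delta \mid \lnot\delta \mid \bigcirc^{\mathsf{f}}\delta \mid \mu Y.\delta$ with $\mathsf{f}\in\{\mathsf{g},\mathsf{a},\mathsf{c}\}$ (global successor, abstract successor, caller), i.e. a linear-time $\mu$-calculus with CaRet-like modalities, interpreted on single traces. Multitrace formulae are $\psi ::= [\delta]_\pi \mid X \mid \psi\lor\psi \mid \lnot\psi \mid \bigcirc^{\Delta}\psi \mid \mu X.\psi$, where $[\delta]_\pi$ tests $\delta$ at the current position of trace $\pi$, and $\Delta$ is a successor assignment mapping each trace variable $\pi$ to a trace formula; $\bigcirc^\Delta\psi$ advances every trace $\pi$ simultaneously to the next position where $\Delta(\pi)$ holds (or to the immediate successor position if no such later position exists) and evaluates $\psi$ there. Hyperproperty formulae are $\varphi ::= \exists\pi.\varphi \mid \forall\pi.\varphi \mid \psi$, with trace quantifiers ranging over the traces of the model; $\varphi$ holds if $\psi$ holds at the initial positions $(0,\dots,0)$. Here different $\bigcirc^\Delta$ operators in a formula may use different successor assignments $\Delta$. On Kripke structures (finite state systems with only internal transitions), the finite state model checking problem asks, given a closed formula $\varphi$ and a (possibly fair) Kripke structure $\mathcal{K}$,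 whether the set of traces of $\mathcal{K}$ satisfies $\varphi$. *)

theory Defs
  imports Main "HOL-Library.Nat_Bijection"
begin

datatype succ_kind = SuccG | SuccA | SuccC

datatype tform =
    TAp nat
  | TVar nat
  | TOr tform tform
  | TNot tform
  | TNext succ_kind tform
  | TMu nat tform

text \<open>A successor assignment is given as a finite association list from trace variables
  to trace formulae (looked up with map_of).\<close>
datatype mform =
    MTest tform nat
  | MVar nat
  | MOr mform mform
  | MNot mform
  | MNext "(nat \<times> tform) list" mform
  | MMu nat mform

datatype hform =
    HEx nat hform
  | HAll nat hform
  | HBody mform

type_synonym trace = "nat \<Rightarrow> nat set"

text \<open>Successor functions. On Kripke structures all transitions are internal, so every
  position is internal: the global and abstract successor of i is i+1 and the caller
  is undefined.\<close>
fun tsucc :: "succ_kind \<Rightarrow> nat \<Rightarrow> nat option" where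
  "tsucc SuccG i = Some (Suc i)"
| "tsucc SuccA i = Some (Suc i)"
| "tsucc SuccC i = None"

fun tsem :: "trace \<Rightarrow> (nat \<Rightarrow> nat set) \<Rightarrow> tform \<Rightarrow> nat set" where
  "tsem w V (TAp a) = {i. a \<in> w i}"
| "tsem w V (TVar Y) = V Y"
| "tsem w V (TOr d1 d2) = tsem w V d1 \<union> tsem w V d2"
| "tsem w V (TNot d) = - tsem w V d"
| "tsem w V (TNext f d) = {i. \<exists>j. tsucc f i = Some j \<and> j \<in> tsem w V d}"
| "tsem w V (TMu Y d) = lfp (\<lambda>S. tsem w (V(Y := S)) d)"

definition next_pos :: "nat set \<Rightarrow> nat \<Rightarrow> nat" where
  "next_pos S i = (if \<exists>j. i < j \<and> j \<in> S then (LEAST j. i < j \<and> j \<in> S) else Suc i)"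

definition advance :: "(nat \<Rightarrow> trace) \<Rightarrow> (nat \<times> tform) list \<Rightarrow> (nat \<Rightarrow> nat) \<Rightarrow> (nat \<Rightarrow> nat)" where
  "advance Pi D v = (\<lambda>p. case map_of D p of
       None \<Rightarrow> Suc (v p)
     | Some d \<Rightarrow> next_pos (tsem (Pi p) (\<lambda>_. {}) d) (v p))"

fun msem :: "(nat \<Rightarrow> trace) \<Rightarrow> (nat \<Rightarrow> (nat \<Rightarrow> nat) set) \<Rightarrow> mform \<Rightarrow> (nat \<Rightarrow> nat) set" where
  "msem Pi W (MTest d p) = {v. v p \<in> tsem (Pi p) (\<lambda>_. {}) d}"
| "msem Pi W (MVar X) = W X"
| "msem Pi W (MOr a b) = msem Pi W a \<union> msem Pi W b"
| "msem Pi W (MNot a) = - msem Pi W a"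
| "msem Pi W (MNext D a) = {v. advance Pi D v \<in> msem Pi W a}"
| "msem Pi W (MMu X a) = lfp (\<lambda>S. msem Pi (W(X := S)) a)"

fun hsat :: "trace set \<Rightarrow> (nat \<Rightarrow> trace) \<Rightarrow> hform \<Rightarrow> bool" where
  "hsat T Pi (HEx p f) = (\<exists>t\<in>T. hsat T (Pi(p := t)) f)"
| "hsat T Pi (HAll p f) = (\<forall>t\<in>T. hsat T (Pi(p := t)) f)"
| "hsat T Pi (HBody a) = ((\<lambda>_. 0) \<in> msem Pi (\<lambda>_. {}) a)"

definition models :: "trace set \<Rightarrow> hform \<Rightarrow> bool" where
  "models T f = hsat T (\<lambda>_ _. {}) f"

text \<open>Free occurrences of fixpoint variables with their polarity (True = positive).\<close>
fun tocc :: "bool \<Rightarrow> tform \<Rightarrow> (nat \<times> bool) set" where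
  "tocc p (TAp a) = {}"
| "tocc p (TVar Y) = {(Y, p)}"
| "tocc p (TOr a b) = tocc p a \<union> tocc p b"
| "tocc p (TNot a) = tocc (\<not> p) a"
| "tocc p (TNext f a) = tocc p a"
| "tocc p (TMu Y a) = {(Z, q) \<in> tocc p a. Z \<noteq> Y}"

fun twf :: "tform \<Rightarrow> bool" where
  "twf (TAp a) = True"
| "twf (TVar Y) = True"
| "twf (TOr a b) = (twf a \<and> twf b)"
| "twf (TNot a) = twf a"
| "twf (TNext f a) = twf a"
| "twf (TMu Y a) = (twf a \<and> (Y, False) \<notin> tocc True a)"

definition tclosed :: "tform \<Rightarrow> bool" where
  "tclosed d = (twf d \<and> tocc True d = {})"

fun mocc :: "bool \<Rightarrow> mform \<Rightarrow> (nat \<times> bool) set" where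
  "mocc p (MTest d q) = {}"
| "mocc p (MVar X) = {(X, p)}"
| "mocc p (MOr a b) = mocc p a \<union> mocc p b"
| "mocc p (MNot a) = mocc (\<not> p) a"
| "mocc p (MNext D a) = mocc p a"
| "mocc p (MMu X a) = {(Z, q) \<in> mocc p a. Z \<noteq> X}"

fun mok :: "nat set \<Rightarrow> mform \<Rightarrow> bool" where
  "mok G (MTest d p) = (p \<in> G \<and> tclosed d)"
| "mok G (MVar X) = True"
| "mok G (MOr a b) = (mok G a \<and> mok G b)"
| "mok G (MNot a) = mok G a"
| "mok G (MNext D a) = (G \<subseteq> fst ` set D \<and> (\<forall>(p, d) \<in> set D. tclosed d) \<and> mok G a)"
| "mok G (MMu X a) = (mok G a \<and> (X, False) \<notin> mocc True a)"

fun hok :: "nat set \<Rightarrow> hform \<Rightarrow> bool" where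
  "hok G (HEx p f) = hok (insert p G) f"
| "hok G (HAll p f) = hok (insert p G) f"
| "hok G (HBody a) = (mok G a \<and> mocc True a = {})"

definition hclosed :: "hform \<Rightarrow> bool" where
  "hclosed f = hok {} f"

text \<open>Kripke n inits edges labels: states 0..n-1, initial states, transitions,
  and the labelling (label of state s is set (labels ! s)).\<close>
datatype kripke = Kripke nat "nat list" "(nat \<times> nat) list" "nat list list"

fun kwf :: "kripke \<Rightarrow> bool" where
  "kwf (Kripke n I E L) =
     (length L = n \<and> (\<forall>s \<in> set I. s < n) \<and> (\<forall>(s, t) \<in> set E. s < n \<and> t < n))"

fun ktraces :: "kripke \<Rightarrow> trace set" where
  "ktraces (Kripke n I E L) =
     {(\<lambda>i. set (L ! (r i))) | r. r 0 \<in> set I \<and> (\<forall>i. (r i, r (Suc i)) \<in> set E)}"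

fun enc_sk :: "succ_kind \<Rightarrow> nat" where
  "enc_sk SuccG = 0" | "enc_sk SuccA = 1" | "enc_sk SuccC = 2"

fun enc_t :: "tform \<Rightarrow> nat" where
  "enc_t (TAp a) = prod_encode (0, a)"
| "enc_t (TVar Y) = prod_encode (1, Y)"
| "enc_t (TOr a b) = prod_encode (2, prod_encode (enc_t a, enc_t b))"
| "enc_t (TNot a) = prod_encode (3, enc_t a)"
| "enc_t (TNext f a) = prod_encode (4, prod_encode (enc_sk f, enc_t a))"
| "enc_t (TMu Y a) = prod_encode (5, prod_encode (Y, enc_t a))"

fun enc_m :: "mform \<Rightarrow> nat" where
  "enc_m (MTest d p) = prod_encode (0, prod_encode (enc_t d, p))"
| "enc_m (MVar X) = prod_encode (1, X)"
| "enc_m (MOr a b) = prod_encode (2, prod_encode (enc_m a, enc_m b))"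
| "enc_m (MNot a) = prod_encode (3, enc_m a)"
| "enc_m (MNext D a) = prod_encode (4, prod_encode
     (list_encode (map (\<lambda>(p, d). prod_encode (p, enc_t d)) D), enc_m a))"
| "enc_m (MMu X a) = prod_encode (5, prod_encode (X, enc_m a))"

fun enc_h :: "hform \<Rightarrow> nat" where
  "enc_h (HEx p f) = prod_encode (0, prod_encode (p, enc_h f))"
| "enc_h (HAll p f) = prod_encode (1, prod_encode (p, enc_h f))"
| "enc_h (HBody a) = prod_encode (2, enc_m a)"

fun enc_k :: "kripke \<Rightarrow> nat" where
  "enc_k (Kripke n I E L) = prod_encode (n, prod_encode (list_encode I,
     prod_encode (list_encode (map prod_encode E), list_encode (map list_encode L))))"

datatype recf = RZ | RS | RProj nat | RComp recf "recf list" | RPrec recf recf | RMn recf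

inductive reval :: "recf \<Rightarrow> nat list \<Rightarrow> nat \<Rightarrow> bool" where
  zero: "reval RZ xs 0"
| suc: "reval RS (x # xs) (Suc x)"
| proj: "i < length xs \<Longrightarrow> reval (RProj i) xs (xs ! i)"
| comp: "length ys = length gs \<Longrightarrow> (\<forall>i < length gs. reval (gs ! i) xs (ys ! i))
          \<Longrightarrow> reval f ys z \<Longrightarrow> reval (RComp f gs) xs z"
| prec0: "reval g xs y \<Longrightarrow> reval (RPrec g h) (0 # xs) y"
| precS: "reval (RPrec g h) (n # xs) r \<Longrightarrow> reval h (n # r # xs) y
          \<Longrightarrow> reval (RPrec g h) (Suc n # xs) y"
| mn: "reval f (y # xs) 0 \<Longrightarrow> (\<forall>z < y. \<exists>v. reval f (z # xs) v \<and> 0 < v)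
          \<Longrightarrow> reval (RMn f) xs y"

end

theory Submission
  imports Defs
begin

text \<open>A register program is simulated by a trace assignment in which trace \<open>2 * r\<close> is cut by marks
  into blocks whose lengths are the successive values of register \<open>r\<close>, while trace \<open>2 * r + 1\<close>
  lists the same values shifted by one step. Two block lengths are compared by walking along both
  traces synchronously until a mark appears, and one step of the program is checked by comparing
  the current blocks of the two kinds of traces and then jumping with every trace to its next mark;
  loops become fixpoints. Hence a program that terminates with output \<open>t\<close> is turned into a
  formula, existentially quantified over all traces, that holds iff \<open>t = 0\<close>.

  A decision procedure \<open>f\<close> is refuted by diagonalisation. Prefixing a formula body with \<open>x\<close> copies
  of an increment loads \<open>x\<close> into register 0 and acts on codes as an \<open>x\<close>-fold iterated pairing with
  constants. With \<open>x\<close> the code of the body itself, a program can therefore compute the code of the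
  complete formula it is run by, apply \<open>f\<close> to it and output the verdict, so that the formula holds
  iff \<open>f\<close> says that it does not.\<close>

section \<open>Multitrace formulae\<close>

text \<open>The flag \<open>p\<close> is generalised because each negation swaps the two inclusions.
  At a fixpoint the rebound variable receives the same set on both sides, and \<open>lfp\<close> is
  monotone in its functional.\<close>

lemma msem_polarity:
  assumes "\<And>X. (X, True) \<in> mocc p a \<Longrightarrow> W X \<subseteq> W' X"
    and "\<And>X. (X, False) \<in> mocc p a \<Longrightarrow> W' X \<subseteq> W X"
  shows "if p then msem Pi W a \<subseteq> msem Pi W' a else msem Pi W' a \<subseteq> msem Pi W a"
  using assms
proof (induction a arbitrary: p W W')
  case (MVar X)
  then show ?case by (cases p) auto
next
  case (MOr a b)
  have "if p then msem Pi W a \<subseteq> msem Pi W' a else msem Pi W' a \<subseteq> msem Pi W a"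
    using MOr.prems by (intro MOr.IH(1)) auto
  moreover have "if p then msem Pi W b \<subseteq> msem Pi W' b else msem Pi W' b \<subseteq> msem Pi W b"
    using MOr.prems by (intro MOr.IH(2)) auto
  ultimately show ?case by (cases p) auto
next
  case (MNot a)
  have "if \<not> p then msem Pi W a \<subseteq> msem Pi W' a else msem Pi W' a \<subseteq> msem Pi W a"
    using MNot.prems by (intro MNot.IH) auto
  then show ?case by (cases p) auto
next
  case (MNext D a)
  have "if p then msem Pi W a \<subseteq> msem Pi W' a else msem Pi W' a \<subseteq> msem Pi W a"
    using MNext.prems by (intro MNext.IH) auto
  then show ?case by (cases p) auto
next
  case (MMu X a)
  have "if p then msem Pi (W(X := S)) a \<subseteq> msem Pi (W'(X := S)) a
        else msem Pi (W'(X := S)) a \<subseteq> msem Pi (W(X := S)) a" for S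
    using MMu.prems by (intro MMu.IH) auto
  then show ?case by (cases p) (simp_all add: lfp_mono)
qed auto

lemma msem_cong:
  assumes "\<And>X. X \<in> fst ` mocc True a \<Longrightarrow> W X = W' X"
  shows "msem Pi W a = msem Pi W' a"
proof -
  have "W X = W' X" if "(X, q) \<in> mocc True a" for X q
    using assms that by force
  then show ?thesis
    using msem_polarity[of True a W W' Pi] msem_polarity[of True a W' W Pi]
    by (metis order_refl subset_antisym)
qed

text \<open>The syntactic polarity condition supplies the monotonicity without which
  \<open>lfp\<close> need not be a fixpoint.\<close>

lemma msem_mu_unfold:
  assumes "(X, False) \<notin> mocc True a"
  shows "msem Pi W (MMu X a) = msem Pi (W(X := msem Pi W (MMu X a))) a"
proof -
  have "mono (\<lambda>S. msem Pi (W(X := S)) a)"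
  proof (rule monoI)
    fix S T :: "(nat \<Rightarrow> nat) set" assume "S \<subseteq> T"
    then show "msem Pi (W(X := S)) a \<subseteq> msem Pi (W(X := T)) a"
      using msem_polarity[of True a "W(X := S)" "W(X := T)" Pi] assms by fastforce
  qed
  from lfp_unfold[OF this] show ?thesis by simp
qed

section \<open>Conjunctions and successor assignments\<close>

definition mand :: "mform \<Rightarrow> mform \<Rightarrow> mform" where
  "mand a b = MNot (MOr (MNot a) (MNot b))"

definition mconj :: "mform list \<Rightarrow> mform \<Rightarrow> mform" where
  "mconj as c = foldr mand as c"

lemma msem_mand [simp]: "msem Pi W (mand a b) = msem Pi W a \<inter> msem Pi W b"
  by (auto simp: mand_def)

lemma mocc_mand [simp]: "mocc p (mand a b) = mocc p a \<union> mocc p b"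
  by (auto simp: mand_def)

lemma mok_mand [simp]: "mok G (mand a b) \<longleftrightarrow> mok G a \<and> mok G b"
  by (auto simp: mand_def)

lemma msem_mconj [simp]: "v \<in> msem Pi W (mconj as c) \<longleftrightarrow> (\<forall>a\<in>set as. v \<in> msem Pi W a) \<and> v \<in> msem Pi W c"
  by (induction as) (auto simp: mconj_def)

lemma mocc_mconj [simp]: "mocc p (mconj as c) = (\<Union>a\<in>set as. mocc p a) \<union> mocc p c"
  by (induction as) (auto simp: mconj_def)

lemma mok_mconj [simp]: "mok G (mconj as c) \<longleftrightarrow> (\<forall>a\<in>set as. mok G a) \<and> mok G c"
  by (induction as) (auto simp: mconj_def)

text \<open>The fixed range provides the entry that \<open>mok\<close> demands for each quantified
  trace.\<close>

definition asgn :: "nat \<Rightarrow> (nat \<Rightarrow> tform) \<Rightarrow> (nat \<times> tform) list" where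
  "asgn N f = map (\<lambda>p. (p, f p)) [0..<2 * N]"

lemma map_of_asgn: "map_of (asgn N f) p = (if p < 2 * N then Some (f p) else None)"
proof -
  have "map_of (map (\<lambda>p. (p, f p)) xs) p = (if p \<in> set xs then Some (f p) else None)" for xs
    by (induction xs) auto
  then show ?thesis by (simp add: asgn_def)
qed

lemma advance_asgn:
  "advance Pi (asgn N f) v p =
     (if p < 2 * N then next_pos (tsem (Pi p) (\<lambda>_. {}) (f p)) (v p) else Suc (v p))"
  by (simp add: advance_def map_of_asgn)

lemma mok_next_asgn:
  "mok {..<2 * N} (MNext (asgn N f) a) \<longleftrightarrow> (\<forall>p<2 * N. tclosed (f p)) \<and> mok {..<2 * N} a"
  by (auto simp: asgn_def image_image)

declare mok.simps(5) [simp del]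

definition ttrue :: tform where "ttrue = TOr (TAp 0) (TNot (TAp 0))"
abbreviation tmark :: tform where "tmark \<equiv> TAp 0"
abbreviation tnext :: "tform \<Rightarrow> tform" where "tnext \<equiv> TNext SuccG"

lemma tsem_ttrue [simp]: "tsem w V ttrue = UNIV"
  by (auto simp: ttrue_def)

lemma tclosed_simps [simp]: "tclosed ttrue" "tclosed tmark" "tclosed (tnext d) = tclosed d"
  by (auto simp: ttrue_def tclosed_def)

lemma next_pos_UNIV [simp]: "next_pos UNIV i = Suc i"
proof -
  have "(LEAST j. i < j) = Suc i" by (rule Least_equality) auto
  then show ?thesis by (auto simp: next_pos_def)
qed

text \<open>One inclusion holds since the right-hand set is a prefixed point, the other by unfolding
  the fixpoint \<open>k\<close> times. Leastness forces a walk to end after finitely many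
  steps.\<close>

lemma lfp_until:
  fixes A B :: "'a set" and g :: "'a \<Rightarrow> 'a"
  shows "lfp (\<lambda>S. A \<union> (B \<inter> {v. g v \<in> S})) = {v. \<exists>k. (g ^^ k) v \<in> A \<and> (\<forall>j<k. (g ^^ j) v \<in> B)}"
    (is "lfp ?F = ?R")
proof
  have mono: "mono ?F" by (auto intro!: monoI)
  show "lfp ?F \<subseteq> ?R"
  proof (rule lfp_lowerbound, rule subsetI)
    fix v assume "v \<in> ?F ?R"
    then consider "v \<in> A" | k where "v \<in> B" "(g ^^ k) (g v) \<in> A" "\<forall>j<k. (g ^^ j) (g v) \<in> B"
      by auto
    then show "v \<in> ?R"
    proof cases
      case 1
      then show ?thesis by (auto intro!: exI[of _ 0])
    next
      case 2
      then show ?thesis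
        by (auto intro!: exI[of _ "Suc k"] simp: funpow_swap1 less_Suc_eq_0_disj)
    qed
  qed
  have "v \<in> lfp ?F" if "(g ^^ k) v \<in> A" "\<forall>j<k. (g ^^ j) v \<in> B" for k v
    using that
  proof (induction k arbitrary: v)
    case 0
    then show ?case by (subst lfp_unfold[OF mono]) auto
  next
    case (Suc k)
    have "g v \<in> lfp ?F"
      using Suc.prems by (intro Suc.IH) (auto simp: funpow_swap1)
    moreover have "v \<in> B" using Suc.prems(2) by (metis funpow_0 zero_less_Suc)
    ultimately show ?case by (subst lfp_unfold[OF mono]) auto
  qed
  then show "?R \<subseteq> lfp ?F" by auto
qed

text \<open>The two first hits must be simultaneous: the walk goes on only while neither test holds,
  so it fails once exactly one of them does. Variable 0 cannot clash with a loop variable, because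
  the formula is closed.\<close>

definition mwalk :: "nat \<Rightarrow> tform \<Rightarrow> nat \<Rightarrow> tform \<Rightarrow> nat \<Rightarrow> mform" where
  "mwalk N d p e q = MMu 0 (MOr (mand (MTest d p) (MTest e q))
     (mand (mand (MNot (MTest d p)) (MNot (MTest e q)))
           (MNext (asgn N (\<lambda>_. ttrue)) (MVar 0))))"

lemma msem_mwalk:
  "v \<in> msem Pi W (mwalk N d p e q) \<longleftrightarrow>
    (\<exists>k. v p + k \<in> tsem (Pi p) (\<lambda>_. {}) d \<and> v q + k \<in> tsem (Pi q) (\<lambda>_. {}) e \<and>
      (\<forall>j<k. v p + j \<notin> tsem (Pi p) (\<lambda>_. {}) d \<and> v q + j \<notin> tsem (Pi q) (\<lambda>_. {}) e))"
proof -
  let ?g = "\<lambda>v :: nat \<Rightarrow> nat. \<lambda>p. Suc (v p)"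
  have adv: "advance Pi (asgn N (\<lambda>_. ttrue)) = ?g"
    by (auto simp: advance_asgn fun_eq_iff)
  have pow: "(?g ^^ k) v = (\<lambda>p. v p + k)" for k v
    by (induction k) auto
  show ?thesis by (simp add: mwalk_def adv lfp_until pow)
qed

lemma mocc_mwalk [simp]: "mocc b (mwalk N d p e q) = {}"
  by (auto simp: mwalk_def)

lemma mok_mwalk [simp]:
  "mok {..<2 * N} (mwalk N d p e q) \<longleftrightarrow> p < 2 * N \<and> q < 2 * N \<and> tclosed d \<and> tclosed e"
  by (auto simp: mwalk_def mok_next_asgn)

section \<open>Unary numbers as blocks of a trace\<close>

text \<open>Only positions strictly after \<open>i\<close> are inspected, so position 0 can start a
  block without carrying a mark.\<close>

definition blk :: "trace \<Rightarrow> nat \<Rightarrow> nat \<Rightarrow> bool" where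
  "blk w i n \<longleftrightarrow> 0 \<in> w (Suc (i + n)) \<and> (\<forall>j<n. 0 \<notin> w (Suc (i + j)))"

lemma blk_unique: "blk w i m \<Longrightarrow> blk w i n \<Longrightarrow> m = n"
  unfolding blk_def by (metis linorder_neqE_nat)

lemma blk_next_pos:
  assumes "blk w i n"
  shows "next_pos {j. 0 \<in> w j} i = Suc (i + n)"
proof -
  have "(LEAST j. i < j \<and> 0 \<in> w j) = Suc (i + n)"
  proof (rule Least_equality)
    fix y assume y: "i < y \<and> 0 \<in> w y"
    show "Suc (i + n) \<le> y"
    proof (rule ccontr)
      assume "\<not> Suc (i + n) \<le> y"
      then have "y - Suc i < n" "y = Suc (i + (y - Suc i))" using y by auto
      then show False using y assms unfolding blk_def by metis
    qed
  qed (use assms in \<open>auto simp: blk_def\<close>)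
  moreover have "\<exists>j. i < j \<and> 0 \<in> w j"
    using assms by (auto simp: blk_def intro!: exI[of _ "Suc (i + n)"])
  ultimately show ?thesis by (simp add: next_pos_def)
qed

definition mzero :: "nat \<Rightarrow> mform" where
  "mzero p = MTest (tnext tmark) p"

definition meq :: "nat \<Rightarrow> nat \<Rightarrow> nat \<Rightarrow> mform" where
  "meq N p q = mwalk N (tnext tmark) p (tnext tmark) q"

text \<open>The walk on \<open>q\<close> looks two positions ahead and thus skips the position right
  after its start; the negated \<open>mzero\<close> covers exactly that position.\<close>

definition msuc :: "nat \<Rightarrow> nat \<Rightarrow> nat \<Rightarrow> mform" where
  "msuc N p q = mand (MNot (mzero q)) (mwalk N (tnext tmark) p (tnext (tnext tmark)) q)"

text \<open>The current block of trace \<open>2 * r + 1\<close> equals the next block of trace \<open>2 * r\<close>. The first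
  step leaves the odd traces one position late, hence their walk stops at a mark instead of in
  front of one.\<close>
definition mchain :: "nat \<Rightarrow> nat \<Rightarrow> mform" where
  "mchain N r = MNext (asgn N (\<lambda>p. if even p then tmark else ttrue))
     (mwalk N (tnext tmark) (2 * r) tmark (2 * r + 1))"

lemma mocc_tests [simp]:
  "mocc b (mzero p) = {}" "mocc b (meq N p q) = {}" "mocc b (msuc N p q) = {}" "mocc b (mchain N r) = {}"
  by (auto simp: mzero_def meq_def msuc_def mchain_def)

lemma mok_tests [simp]:
  "mok {..<2 * N} (mzero p) \<longleftrightarrow> p < 2 * N"
  "mok {..<2 * N} (meq N p q) \<longleftrightarrow> p < 2 * N \<and> q < 2 * N"
  "mok {..<2 * N} (msuc N p q) \<longleftrightarrow> p < 2 * N \<and> q < 2 * N"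
  "mok {..<2 * N} (mchain N r) \<longleftrightarrow> r < N"
  unfolding mchain_def mok_next_asgn
  by (auto simp: mzero_def meq_def msuc_def)

lemma msem_mzero: "v \<in> msem Pi W (mzero p) \<longleftrightarrow> blk (Pi p) (v p) 0"
  by (simp add: mzero_def blk_def)

lemma msem_meq: "v \<in> msem Pi W (meq N p q) \<longleftrightarrow> (\<exists>k. blk (Pi p) (v p) k \<and> blk (Pi q) (v q) k)"
  by (auto simp: meq_def msem_mwalk blk_def)

lemma blk_Suc: "blk w i (Suc n) \<longleftrightarrow> 0 \<notin> w (Suc i) \<and> blk w (Suc i) n"
  by (auto simp: blk_def less_Suc_eq_0_disj)

lemma msem_msuc: "v \<in> msem Pi W (msuc N p q) \<longleftrightarrow> (\<exists>k. blk (Pi p) (v p) k \<and> blk (Pi q) (v q) (Suc k))"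
  by (auto simp: msuc_def msem_mwalk blk_Suc mzero_def) (auto simp: blk_def)

text \<open>Under the mixed assignment the even trace jumps to its next block while the odd trace
  moves a single step and stays within reach of its current one. Together with synchronous walks and
  common jumps to the next marks, this is where different successor assignments meet in one
  formula.\<close>

lemma msem_mchain:
  assumes "r < N"
  shows "v \<in> msem Pi W (mchain N r) \<longleftrightarrow>
    (\<exists>k. blk (Pi (2 * r)) (next_pos {j. 0 \<in> Pi (2 * r) j} (v (2 * r))) k
       \<and> blk (Pi (2 * r + 1)) (v (2 * r + 1)) k)"
  using assms by (auto simp: mchain_def msem_mwalk advance_asgn blk_def)

section \<open>Register programs\<close>

datatype rhs = RZero | RReg nat | RSuc nat

fun rval :: "(nat \<Rightarrow> nat) \<Rightarrow> rhs \<Rightarrow> nat" where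
  "rval s RZero = 0"
| "rval s (RReg r) = s r"
| "rval s (RSuc r) = Suc (s r)"

fun rregs :: "rhs \<Rightarrow> nat set" where
  "rregs RZero = {}"
| "rregs (RReg r) = {r}"
| "rregs (RSuc r) = {r}"

datatype com = Skip | Asg nat rhs | Seq com com | Until nat nat com

fun regs :: "com \<Rightarrow> nat set" where
  "regs Skip = {}"
| "regs (Asg b e) = insert b (rregs e)"
| "regs (Seq c d) = regs c \<union> regs d"
| "regs (Until r s c) = {r, s} \<union> regs c"

inductive exec :: "com \<Rightarrow> (nat \<Rightarrow> nat) \<Rightarrow> (nat \<Rightarrow> nat) \<Rightarrow> bool" where
  skip: "exec Skip s s"
| asg: "exec (Asg b e) s (s(b := rval s e))"
| seq: "exec c s t \<Longrightarrow> exec d t u \<Longrightarrow> exec (Seq c d) s u"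
| until_stop: "s q = s r \<Longrightarrow> exec (Until q r c) s s"
| until_step: "s q \<noteq> s r \<Longrightarrow> exec c s t \<Longrightarrow> exec (Until q r c) t u \<Longrightarrow> exec (Until q r c) s u"

fun mrel :: "nat \<Rightarrow> nat \<Rightarrow> rhs \<Rightarrow> mform" where
  "mrel N b RZero = mzero (2 * b + 1)"
| "mrel N b (RReg r) = meq N (2 * r) (2 * b + 1)"
| "mrel N b (RSuc r) = msuc N (2 * r) (2 * b + 1)"

text \<open>The odd traces carry a guess of the next state: it must give \<open>b\<close> its new
  value, keep all other registers, and be copied to the next even blocks by
  \<open>mchain\<close>.\<close>

definition masg :: "nat \<Rightarrow> nat \<Rightarrow> rhs \<Rightarrow> mform list" where
  "masg N b e = mrel N b e # map (mchain N) [0..<N]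
     @ map (\<lambda>r. meq N (2 * r) (2 * r + 1)) (filter (\<lambda>r. r \<noteq> b) [0..<N])"

abbreviation blocks :: "nat \<Rightarrow> (nat \<times> tform) list" where
  "blocks N \<equiv> asgn N (\<lambda>_. tmark)"

text \<open>The continuation \<open>C\<close> may mention fixpoint variables below \<open>n\<close>, those of the enclosing loops.\<close>
fun tr :: "nat \<Rightarrow> com \<Rightarrow> nat \<Rightarrow> mform \<Rightarrow> mform" where
  "tr N Skip n C = C"
| "tr N (Asg b e) n C = mconj (masg N b e) (MNext (blocks N) C)"
| "tr N (Seq c d) n C = tr N c n (tr N d n C)"
| "tr N (Until q r c) n C =
     MMu n (MOr (mand (meq N (2 * q) (2 * r)) C)
                (mand (MNot (meq N (2 * q) (2 * r))) (tr N c (Suc n) (MVar n))))"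

lemma mocc_masg: "a \<in> set (masg N b e) \<Longrightarrow> mocc p a = {}"
  by (cases e) (auto simp: masg_def)

text \<open>Continuations are only placed under an even number of negations, and \<open>MMu\<close>
  binds the variable through which the loop body jumps back. Preserving polarity makes the fixpoints
  well-formed.\<close>

lemma mocc_tr: "mocc p (tr N c n C) \<subseteq> mocc p C"
proof (induction c arbitrary: p n C)
  case (Seq c d)
  have "mocc p (tr N c n (tr N d n C)) \<subseteq> mocc p (tr N d n C)"
    by (rule Seq.IH(1))
  also have "\<dots> \<subseteq> mocc p C"
    by (rule Seq.IH(2))
  finally show ?case by simp
next
  case (Until q r c)
  show ?case using Until.IH[of p "Suc n" "MVar n"] by auto
qed (auto simp: mocc_masg)

lemma mok_tr:
  assumes "regs c \<subseteq> {..<N}" "mok {..<2 * N} C"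
    "fst ` mocc True C \<subseteq> {..<n}"
  shows "mok {..<2 * N} (tr N c n C)"
  using assms
proof (induction c arbitrary: n C)
  case (Asg b e)
  have "a \<in> set (masg N b e) \<Longrightarrow> mok {..<2 * N} a" for a
    using Asg.prems(1) by (cases e) (auto simp: masg_def)
  then show ?case using Asg.prems by (simp add: mok_next_asgn)
next
  case (Seq c d)
  have "fst ` mocc True (tr N d n C) \<subseteq> {..<n}"
    using Seq.prems(3) mocc_tr by fastforce
  then show ?case using Seq by simp
next
  case (Until q r c)
  have "mok {..<2 * N} (tr N c (Suc n) (MVar n))"
    using Until.prems by (intro Until.IH) auto
  moreover have "(n, False) \<notin> mocc True (tr N c (Suc n) (MVar n))"
    using mocc_tr[of True N c "Suc n" "MVar n"] by auto
  moreover have "(n, False) \<notin> mocc True C"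
    using Until.prems(3) by force
  ultimately show ?case using Until.prems by simp
qed auto

text \<open>Freshness of \<open>n\<close> for \<open>C\<close> lets the exit branch be read in
  \<open>W\<close> after one unfolding. The valuation \<open>W'\<close> is exposed only at
  \<open>n\<close>, the single variable that the translated loop body can mention.\<close>

lemma msem_tr_until:
  assumes "fst ` mocc True C \<subseteq> {..<n}"
  obtains W' where "msem Pi W (tr N (Until q r c) n C) =
      (msem Pi W (meq N (2 * q) (2 * r)) \<inter> msem Pi W C) \<union>
      (- msem Pi W (meq N (2 * q) (2 * r)) \<inter> msem Pi W' (tr N c (Suc n) (MVar n)))"
    and "W' n = msem Pi W (tr N (Until q r c) n C)"
proof
  let ?W = "W(n := msem Pi W (tr N (Until q r c) n C))"
  let ?a = "MOr (mand (meq N (2 * q) (2 * r)) C)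
                (mand (MNot (meq N (2 * q) (2 * r))) (tr N c (Suc n) (MVar n)))"
  have "(n, False) \<notin> mocc True C"
    using assms by force
  then have "(n, False) \<notin> mocc True ?a"
    using mocc_tr[of True N c "Suc n" "MVar n"] by auto
  from msem_mu_unfold[OF this, of Pi W]
  have "msem Pi W (tr N (Until q r c) n C) = msem Pi ?W ?a"
    by (metis tr.simps(4))
  moreover have "msem Pi ?W C = msem Pi W C"
    using assms by (intro msem_cong) auto
  moreover have "msem Pi ?W (meq N (2 * q) (2 * r)) = msem Pi W (meq N (2 * q) (2 * r))"
    by (intro msem_cong) auto
  ultimately show "msem Pi W (tr N (Until q r c) n C) =
      (msem Pi W (meq N (2 * q) (2 * r)) \<inter> msem Pi W C) \<union>
      (- msem Pi W (meq N (2 * q) (2 * r)) \<inter> msem Pi ?W (tr N c (Suc n) (MVar n)))"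
    by (metis msem.simps(3,4) msem_mand)
  show "?W n = msem Pi W (tr N (Until q r c) n C)" by simp
qed

section \<open>Soundness of the translation along a terminating run\<close>

definition encodes :: "nat \<Rightarrow> (nat \<Rightarrow> trace) \<Rightarrow> (nat \<Rightarrow> nat) \<Rightarrow> (nat \<Rightarrow> nat) \<Rightarrow> bool" where
  "encodes N Pi v s \<longleftrightarrow> (\<forall>r<N. blk (Pi (2 * r)) (v (2 * r)) (s r))"

text \<open>Both blocks exist and have unique lengths, so a failing \<open>meq\<close> really means
  that the register values differ.\<close>

lemma encodes_meq:
  assumes "encodes N Pi v s" "q < N" "r < N"
  shows "v \<in> msem Pi W (meq N (2 * q) (2 * r)) \<longleftrightarrow> s q = s r"
  using assms unfolding msem_meq encodes_def by (metis blk_unique)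

text \<open>Since lengths are unique, \<open>mchain\<close> transfers whatever value the odd block
  carries to the next even block. Soundness uses the equivalence from left to right, completeness
  from right to left.\<close>

lemma encodes_masg:
  assumes "encodes N Pi v s" "insert b (rregs e) \<subseteq> {..<N}"
  shows "(\<forall>a\<in>set (masg N b e). v \<in> msem Pi W a) \<longleftrightarrow>
     (\<forall>r<N. blk (Pi (2 * r + 1)) (v (2 * r + 1)) ((s(b := rval s e)) r)) \<and>
     encodes N Pi (advance Pi (blocks N) v) (s(b := rval s e))"
proof -
  define t where "t = s(b := rval s e)"
  let ?B = "\<lambda>r k. blk (Pi (2 * r + 1)) (v (2 * r + 1)) k"
  have A: "blk (Pi (2 * r)) (v (2 * r)) k \<longleftrightarrow> k = s r" if "r < N" for r k
    using assms(1) that unfolding encodes_def by (metis blk_unique)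
  have adv: "advance Pi (blocks N) v (2 * r) = next_pos {j. 0 \<in> Pi (2 * r) j} (v (2 * r))" if "r < N" for r
    using that by (simp add: advance_asgn)
  have rel: "v \<in> msem Pi W (mrel N b e) \<longleftrightarrow> ?B b (t b)"
    using assms(2) A by (cases e) (auto simp: t_def msem_mzero msem_meq msem_msuc)
  have eq: "v \<in> msem Pi W (meq N (2 * r) (2 * r + 1)) \<longleftrightarrow> ?B r (t r)" if "r < N" "r \<noteq> b" for r
    using A that by (auto simp: msem_meq t_def)
  have "(\<forall>a\<in>set (masg N b e). v \<in> msem Pi W a) \<longleftrightarrow>
      ?B b (t b) \<and> (\<forall>r<N. r \<noteq> b \<longrightarrow> ?B r (t r)) \<and> (\<forall>r<N. v \<in> msem Pi W (mchain N r))"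
    using rel eq by (auto simp: masg_def)
  also have "\<dots> \<longleftrightarrow> (\<forall>r<N. ?B r (t r)) \<and> (\<forall>r<N. v \<in> msem Pi W (mchain N r))"
    using assms(2) by auto
  also have "\<dots> \<longleftrightarrow> (\<forall>r<N. ?B r (t r)) \<and> encodes N Pi (advance Pi (blocks N) v) t"
    unfolding encodes_def using adv msem_mchain blk_unique by (metis (no_types, lifting))
  finally show ?thesis by (simp add: t_def)
qed

text \<open>Induction follows the run, so each loop iteration costs one unfolding. Entering a loop
  body changes the valuation, hence \<open>W\<close> is arbitrary; reaching \<open>MVar n\<close>
  there leads back to the loop formula.\<close>

lemma tr_sound:
  assumes "exec c s t" "regs c \<subseteq> {..<N}" "fst ` mocc True C \<subseteq> {..<n}"
    "encodes N Pi v s" "v \<in> msem Pi W (tr N c n C)"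
  shows "\<exists>v'. encodes N Pi v' t \<and> v' \<in> msem Pi W C"
  using assms
proof (induction arbitrary: n C v W rule: exec.induct)
  case (asg b e s)
  have "(\<forall>a\<in>set (masg N b e). v \<in> msem Pi W a) \<and> advance Pi (blocks N) v \<in> msem Pi W C"
    using asg.prems(4) by simp
  then show ?case
    using encodes_masg[OF asg.prems(3), of b e W] asg.prems(1) regs.simps(2) by metis
next
  case (seq c s t d u)
  have "fst ` mocc True (tr N d n C) \<subseteq> {..<n}"
    using seq.prems(2) mocc_tr by fastforce
  then obtain v' where "encodes N Pi v' t" "v' \<in> msem Pi W (tr N d n C)"
    using seq.IH(1)[of "tr N d n C" n v W] seq.prems by auto
  then show ?case using seq.IH(2)[of C n v' W] seq.prems by auto
next
  case (until_stop s q r c)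
  obtain W' where "msem Pi W (tr N (Until q r c) n C) =
      (msem Pi W (meq N (2 * q) (2 * r)) \<inter> msem Pi W C) \<union>
      (- msem Pi W (meq N (2 * q) (2 * r)) \<inter> msem Pi W' (tr N c (Suc n) (MVar n)))"
    using msem_tr_until[OF until_stop.prems(2)] by metis
  then have "v \<in> msem Pi W C"
    using until_stop encodes_meq[of N Pi v s q r W] by auto
  then show ?case using until_stop by blast
next
  case (until_step s q r c t u)
  obtain W' where W': "msem Pi W (tr N (Until q r c) n C) =
      (msem Pi W (meq N (2 * q) (2 * r)) \<inter> msem Pi W C) \<union>
      (- msem Pi W (meq N (2 * q) (2 * r)) \<inter> msem Pi W' (tr N c (Suc n) (MVar n)))"
    "W' n = msem Pi W (tr N (Until q r c) n C)"
    using msem_tr_until[OF until_step.prems(2)] by metis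
  have "v \<in> msem Pi W' (tr N c (Suc n) (MVar n))"
    using until_step W'(1) encodes_meq[of N Pi v s q r W] by auto
  then obtain v' where "encodes N Pi v' t" "v' \<in> msem Pi W' (MVar n)"
    using until_step.IH(1)[of "MVar n" "Suc n" v W'] until_step.prems by auto
  then show ?case
    using until_step.IH(2)[of C n v' W] until_step.prems W'(2) by auto
qed auto

section \<open>Completeness: canonical traces of a terminating run\<close>

fun mpos :: "(nat \<Rightarrow> nat) \<Rightarrow> nat \<Rightarrow> nat" where
  "mpos u 0 = 0"
| "mpos u (Suc i) = Suc (mpos u i + u i)"

text \<open>Marks stand at the ends of blocks; the start of the first block, position 0, gets none,
  hence \<open>Suc j\<close>.\<close>

definition strace :: "(nat \<Rightarrow> nat) \<Rightarrow> trace" where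
  "strace u i = (if \<exists>j. i = mpos u (Suc j) then {0} else {})"

lemma mpos_mono: "i < j \<Longrightarrow> Suc (mpos u i + u i) \<le> mpos u j"
  by (induction j) (auto simp: less_Suc_eq)

lemma blk_strace: "blk (strace u) (mpos u i) (u i)"
proof -
  \<comment> \<open>A mark inside block \<open>i\<close> would end some block \<open>j\<close>, but
    earlier blocks end too early, later ones too late, and block \<open>i\<close> itself ends only
    at offset \<open>u i\<close>.\<close>
  have False if "k < u i" "Suc (mpos u i + k) = mpos u (Suc j)" for j k
  proof (cases j i rule: linorder_cases)
    case less
    then have "mpos u (Suc j) \<le> mpos u i" using mpos_mono by simp
    then show ?thesis using that by simp
  next
    case equal
    then show ?thesis using that by simp
  next
    case greater
    then show ?thesis using that mpos_mono[OF greater, of u] by simp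
  qed
  then show ?thesis unfolding blk_def strace_def by fastforce
qed

definition col :: "(nat \<Rightarrow> nat \<Rightarrow> nat) \<Rightarrow> nat \<Rightarrow> nat \<Rightarrow> nat" where
  "col z p i = z (if even p then i else Suc i) (p div 2)"

definition onseq :: "nat \<Rightarrow> (nat \<Rightarrow> trace) \<Rightarrow> (nat \<Rightarrow> nat \<Rightarrow> nat) \<Rightarrow> (nat \<Rightarrow> nat) \<Rightarrow> nat \<Rightarrow> bool" where
  "onseq N Pi z v i \<longleftrightarrow> (\<forall>p<2 * N. Pi p = strace (col z p) \<and> v p = mpos (col z p) i)"

lemma onseq_at: "onseq N Pi z v i \<Longrightarrow> encodes N Pi v (z i)"
  unfolding encodes_def
proof (intro allI impI)
  fix r assume "onseq N Pi z v i" "r < N"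
  then show "blk (Pi (2 * r)) (v (2 * r)) (z i r)"
    using blk_strace[of "col z (2 * r)" i] by (simp add: onseq_def) (simp add: col_def)
qed

lemma onseq_advance:
  assumes "onseq N Pi z v i"
  shows "onseq N Pi z (advance Pi (blocks N) v) (Suc i)"
  unfolding onseq_def
proof (intro allI impI conjI)
  fix p assume p: "p < 2 * N"
  with assms show "Pi p = strace (col z p)" by (simp add: onseq_def)
  show "advance Pi (blocks N) v p = mpos (col z p) (Suc i)"
    using assms p blk_next_pos[OF blk_strace[of "col z p" i]] by (simp add: onseq_def advance_asgn)
qed

lemma onseq_odd:
  assumes "onseq N Pi z v i" "r < N"
  shows "blk (Pi (2 * r + 1)) (v (2 * r + 1)) (z (Suc i) r)"
  using assms blk_strace[of "col z (2 * r + 1)" i] by (simp add: onseq_def) (simp add: col_def)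

text \<open>\<open>l\<close> lists the states that follow \<open>s\<close> in a terminating run of \<open>c\<close>.\<close>
definition guides :: "com \<Rightarrow> (nat \<Rightarrow> nat) \<Rightarrow> (nat \<Rightarrow> nat) list \<Rightarrow> bool" where
  "guides c s l \<longleftrightarrow> (\<forall>N Pi z i n C W v. regs c \<subseteq> {..<N} \<longrightarrow> fst ` mocc True C \<subseteq> {..<n} \<longrightarrow>
     (\<forall>j\<le>length l. z (i + j) = (s # l) ! j) \<longrightarrow>
     (\<forall>v. onseq N Pi z v (i + length l) \<longrightarrow> v \<in> msem Pi W C) \<longrightarrow>
     onseq N Pi z v i \<longrightarrow> v \<in> msem Pi W (tr N c n C))"

lemma guidesI:
  assumes "\<And>N Pi z i n C W v. regs c \<subseteq> {..<N} \<Longrightarrow> fst ` mocc True C \<subseteq> {..<n} \<Longrightarrow>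
       (\<And>j. j \<le> length l \<Longrightarrow> z (i + j) = (s # l) ! j) \<Longrightarrow>
       (\<And>v. onseq N Pi z v (i + length l) \<Longrightarrow> v \<in> msem Pi W C) \<Longrightarrow>
       onseq N Pi z v i \<Longrightarrow> v \<in> msem Pi W (tr N c n C)"
  shows "guides c s l"
  unfolding guides_def
proof (intro allI impI)
  fix N Pi z i n C W v
  assume "regs c \<subseteq> {..<N}" "fst ` mocc True C \<subseteq> {..<n}" "\<forall>j\<le>length l. z (i + j) = (s # l) ! j"
    "\<forall>v. onseq N Pi z v (i + length l) \<longrightarrow> v \<in> msem Pi W C" "onseq N Pi z v i"
  then show "v \<in> msem Pi W (tr N c n C)" by (intro assms) auto
qed

lemma guidesD:
  assumes "guides c s l" "regs c \<subseteq> {..<N}" "fst ` mocc True C \<subseteq> {..<n}"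
    and "\<And>j. j \<le> length l \<Longrightarrow> z (i + j) = (s # l) ! j"
    and "\<And>v. onseq N Pi z v (i + length l) \<Longrightarrow> v \<in> msem Pi W C"
    and "onseq N Pi z v i"
  shows "v \<in> msem Pi W (tr N c n C)"
  using assms(1)[unfolded guides_def, rule_format, OF assms(2-6)] by blast

lemma guides_asg: "guides (Asg b e) s [s(b := rval s e)]"
proof (rule guidesI)
  let ?t = "s(b := rval s e)"
  fix N Pi z i n C W v
  assume a: "regs (Asg b e) \<subseteq> {..<N}"
    and z: "\<And>j. j \<le> length [?t] \<Longrightarrow> z (i + j) = (s # [?t]) ! j"
    and C: "\<And>v. onseq N Pi z v (i + length [?t]) \<Longrightarrow> v \<in> msem Pi W C"
    and v: "onseq N Pi z v i"
  have z0: "z i = s" and z1: "z (Suc i) = ?t"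
    using z[of 0] z[of 1] by auto
  have "encodes N Pi v s" "encodes N Pi (advance Pi (blocks N) v) ?t"
    using onseq_at[OF v] onseq_at[OF onseq_advance[OF v]] z0 z1 by simp_all
  moreover have "\<forall>r<N. blk (Pi (2 * r + 1)) (v (2 * r + 1)) (?t r)"
    using onseq_odd[OF v] z1 by simp
  ultimately have "\<forall>a\<in>set (masg N b e). v \<in> msem Pi W a"
    using encodes_masg[of N Pi v s b e W] a regs.simps(2) by metis
  moreover have "advance Pi (blocks N) v \<in> msem Pi W C"
    using C onseq_advance[OF v] by simp
  ultimately show "v \<in> msem Pi W (tr N (Asg b e) n C)" by simp
qed

context
  fixes s t :: "nat \<Rightarrow> nat" and l1 l2 :: "(nat \<Rightarrow> nat) list"
  assumes t: "(s # l1) ! length l1 = t"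
begin

lemma nth_append_left: "j \<le> length l1 \<Longrightarrow> (s # l1 @ l2) ! j = (s # l1) ! j"
  by (metis append_Cons le_imp_less_Suc length_Cons nth_append)

lemma nth_append_right: "(s # l1 @ l2) ! (length l1 + j) = (t # l2) ! j"
  using t nth_append_left[of "length l1"] by (cases j) (auto simp: nth_append)

text \<open>The continuation of the first piece means the translation of the second piece, met at a
  shifted offset. Separate valuations and continuations cover both sequencing, where the valuations
  agree, and a loop, where \<open>C\<close> is the loop variable and stands for the whole
  loop.\<close>

lemma guides_append:
  assumes c: "guides c s l1" "regs c \<subseteq> {..<N}" "fst ` mocc True C \<subseteq> {..<n}"
    and d: "guides d t l2" "regs d \<subseteq> {..<N}" "fst ` mocc True C' \<subseteq> {..<n'}"
    and z: "\<And>j. j \<le> length (l1 @ l2) \<Longrightarrow> z (i + j) = (s # l1 @ l2) ! j"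
    and C': "\<And>v. onseq N Pi z v (i + length (l1 @ l2)) \<Longrightarrow> v \<in> msem Pi W' C'"
    and C: "msem Pi W C = msem Pi W' (tr N d n' C')"
    and v: "onseq N Pi z v i"
  shows "v \<in> msem Pi W (tr N c n C)"
proof (rule guidesD[OF c _ _ v])
  show "z (i + j) = (s # l1) ! j" if "j \<le> length l1" for j
    using z[of j] that nth_append_left by simp
  fix v assume v: "onseq N Pi z v (i + length l1)"
  show "v \<in> msem Pi W C"
    unfolding C
  proof (rule guidesD[OF d _ _ v])
    show "z (i + length l1 + j) = (t # l2) ! j" if "j \<le> length l2" for j
      using z[of "length l1 + j"] that by (simp add: nth_append_right add.assoc)
  qed (use C' in \<open>simp add: add.assoc\<close>)
qed

lemma guides_seq:
  assumes "guides c s l1" "guides d t l2"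
  shows "guides (Seq c d) s (l1 @ l2)"
proof (rule guidesI)
  fix N Pi z i n C W v
  assume a: "regs (Seq c d) \<subseteq> {..<N}" "fst ` mocc True C \<subseteq> {..<n}"
    and z: "\<And>j. j \<le> length (l1 @ l2) \<Longrightarrow> z (i + j) = (s # l1 @ l2) ! j"
    and C: "\<And>v. onseq N Pi z v (i + length (l1 @ l2)) \<Longrightarrow> v \<in> msem Pi W C"
    and v: "onseq N Pi z v i"
  have "fst ` mocc True (tr N d n C) \<subseteq> {..<n}"
    using a(2) mocc_tr by fastforce
  then have "v \<in> msem Pi W (tr N c n (tr N d n C))"
    by (rule guides_append[OF assms(1) _ _ assms(2) _ a(2) z C refl v, rotated]) (use a in auto)
  then show "v \<in> msem Pi W (tr N (Seq c d) n C)" by simp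
qed

lemma guides_until_step:
  assumes "s q \<noteq> s r" "guides c s l1" "guides (Until q r c) t l2"
  shows "guides (Until q r c) s (l1 @ l2)"
proof (rule guidesI)
  fix N Pi z i n C W v
  assume a: "regs (Until q r c) \<subseteq> {..<N}" "fst ` mocc True C \<subseteq> {..<n}"
    and z: "\<And>j. j \<le> length (l1 @ l2) \<Longrightarrow> z (i + j) = (s # l1 @ l2) ! j"
    and C: "\<And>v. onseq N Pi z v (i + length (l1 @ l2)) \<Longrightarrow> v \<in> msem Pi W C"
    and v: "onseq N Pi z v i"
  obtain W' where W': "msem Pi W (tr N (Until q r c) n C) =
      (msem Pi W (meq N (2 * q) (2 * r)) \<inter> msem Pi W C) \<union>
      (- msem Pi W (meq N (2 * q) (2 * r)) \<inter> msem Pi W' (tr N c (Suc n) (MVar n)))"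
    "W' n = msem Pi W (tr N (Until q r c) n C)"
    using msem_tr_until[OF a(2)] by metis
  have "msem Pi W' (MVar n) = msem Pi W (tr N (Until q r c) n C)"
    using W'(2) by simp
  from guides_append[OF assms(2) _ _ assms(3) a z C this v]
  have "v \<in> msem Pi W' (tr N c (Suc n) (MVar n))" using a by simp
  moreover have "encodes N Pi v s" using onseq_at[OF v] z[of 0] by simp
  ultimately show "v \<in> msem Pi W (tr N (Until q r c) n C)"
    unfolding W'(1) using encodes_meq[of N Pi v s q r W] assms(1) a by simp
qed

end

lemma guides_until_stop:
  assumes "s q = s r"
  shows "guides (Until q r c) s []"
proof (rule guidesI)
  fix N Pi z i n C W v
  assume a: "regs (Until q r c) \<subseteq> {..<N}" "fst ` mocc True C \<subseteq> {..<n}"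
    and z: "\<And>j. j \<le> length [] \<Longrightarrow> z (i + j) = (s # []) ! j"
    and C: "\<And>v. onseq N Pi z v (i + length []) \<Longrightarrow> v \<in> msem Pi W C"
    and v: "onseq N Pi z v i"
  obtain W' where W': "msem Pi W (tr N (Until q r c) n C) =
    (msem Pi W (meq N (2 * q) (2 * r)) \<inter> msem Pi W C) \<union>
    (- msem Pi W (meq N (2 * q) (2 * r)) \<inter> msem Pi W' (tr N c (Suc n) (MVar n)))"
    using msem_tr_until[OF a(2)] by metis
  have "encodes N Pi v s" using onseq_at[OF v] z[of 0] by simp
  then show "v \<in> msem Pi W (tr N (Until q r c) n C)"
    unfolding W' using encodes_meq[of N Pi v s q r W] assms a C v by simp
qed

lemma exec_guides: "exec c s t \<Longrightarrow> \<exists>l. (s # l) ! length l = t \<and> guides c s l"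
proof (induction rule: exec.induct)
  case (skip s)
  have "guides Skip s []" by (rule guidesI) simp
  then show ?case by (intro exI[of _ "[]"]) simp
next
  case (asg b e s)
  show ?case using guides_asg by (intro exI[of _ "[s(b := rval s e)]"]) simp
next
  case (seq c s t d u)
  then obtain l1 l2 where l: "(s # l1) ! length l1 = t" "guides c s l1"
    "(t # l2) ! length l2 = u" "guides d t l2" by blast
  show ?case
    using guides_seq[OF l(1,2,4)] nth_append_right[OF l(1), of l2 "length l2"] l(3)
    by (intro exI[of _ "l1 @ l2"]) simp
next
  case (until_stop s q r c)
  then show ?case using guides_until_stop by (intro exI[of _ "[]"]) simp
next
  case (until_step s q r c t u)
  then obtain l1 l2 where l: "(s # l1) ! length l1 = t" "guides c s l1"
    "(t # l2) ! length l2 = u" "guides (Until q r c) t l2" by blast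
  show ?case
    using guides_until_step[OF l(1) until_step.hyps(1) l(2,4)]
      nth_append_right[OF l(1), of l2 "length l2"] l(3)
    by (intro exI[of _ "l1 @ l2"]) simp
qed

section \<open>Compiling recursive functions\<close>

definition wp :: "com \<Rightarrow> ((nat \<Rightarrow> nat) \<Rightarrow> bool) \<Rightarrow> (nat \<Rightarrow> nat) \<Rightarrow> bool" where
  "wp c P s \<longleftrightarrow> (\<exists>t. exec c s t \<and> P t)"

lemma wp_skip: "P s \<Longrightarrow> wp Skip P s"
  unfolding wp_def using exec.skip by blast

lemma wp_asg: "P (s(b := rval s e)) \<Longrightarrow> wp (Asg b e) P s"
  unfolding wp_def using exec.asg by blast

lemma wp_seq: "wp c (wp d P) s \<Longrightarrow> wp (Seq c d) P s"
  unfolding wp_def using exec.seq by blast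

lemma wp_mono: "wp c P s \<Longrightarrow> (\<And>t. P t \<Longrightarrow> Q t) \<Longrightarrow> wp c Q s"
  unfolding wp_def by blast

text \<open>The invariant is indexed by the iteration and the number \<open>n\<close> of rounds is
  known, so induction runs downwards from \<open>n\<close> and yields termination as well.\<close>

lemma wp_until:
  assumes "I 0 s"
    and step: "\<And>i t. i < n \<Longrightarrow> I i t \<Longrightarrow> t q \<noteq> t r \<and> wp c (I (Suc i)) t"
    and stop: "\<And>t. I n t \<Longrightarrow> t q = t r \<and> P t"
  shows "wp (Until q r c) P s"
proof -
  have "wp (Until q r c) P t" if "I i t" "i \<le> n" for i t
    using that(2,1)
  proof (induction arbitrary: t rule: inc_induct)
    case base
    then show ?case using stop until_stop unfolding wp_def by blast
  next
    case (step i)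
    then obtain u where "exec c t u" "I (Suc i) u" "t q \<noteq> t r"
      using assms(2) unfolding wp_def by blast
    then show ?case using step.IH until_step unfolding wp_def by blast
  qed
  then show ?thesis using assms(1) by blast
qed

text \<open>The result goes to register \<open>b\<close>, and all scratch registers lie above \<open>b\<close>.\<close>
fun compile :: "recf \<Rightarrow> nat list \<Rightarrow> nat \<Rightarrow> com"
  and compiles :: "recf list \<Rightarrow> nat list \<Rightarrow> nat \<Rightarrow> com" where
  "compile RZ xs b = Asg b RZero"
| "compile RS xs b = Asg b (RSuc (hd xs))"
| "compile (RProj i) xs b = Asg b (RReg (xs ! i))"
| "compile (RComp f gs) xs b = Seq (compiles gs xs (Suc b))
     (Seq (compile f [Suc b..<Suc b + length gs] (Suc b + length gs)) (Asg b (RReg (Suc b + length gs))))"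
| "compile (RPrec g h) xs b =
     Seq (compile g (tl xs) b) (Seq (Asg (b + 1) RZero) (Until (b + 1) (hd xs)
       (Seq (compile h ((b + 1) # b # tl xs) (b + 2))
         (Seq (Asg b (RReg (b + 2))) (Asg (b + 1) (RSuc (b + 1)))))))"
| "compile (RMn f) xs b =
     Seq (Asg b RZero) (Seq (Asg (b + 1) RZero) (Seq (compile f (b # xs) (b + 2)) (Until (b + 2) (b + 1)
       (Seq (Asg b (RSuc b)) (compile f (b # xs) (b + 2))))))"
| "compiles [] xs b = Skip"
| "compiles (g # gs) xs b = Seq (compile g xs b) (compiles gs xs (Suc b))"

inductive_cases reval_zeroE: "reval RZ xs y"
inductive_cases reval_sucE: "reval RS xs y"
inductive_cases reval_projE: "reval (RProj i) xs y"
inductive_cases reval_compE: "reval (RComp f gs) xs y"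
inductive_cases reval_precE: "reval (RPrec g h) xs y"
inductive_cases reval_prec0E: "reval (RPrec g h) (0 # xs) y"
inductive_cases reval_precSE: "reval (RPrec g h) (Suc n # xs) y"
inductive_cases reval_mnE: "reval (RMn f) xs y"

text \<open>Derivations peel off the last step while the compiled loop counts upwards; collecting
  all intermediate values in \<open>r\<close> lets the loop invariant name the value after
  \<open>i\<close> rounds.\<close>

lemma reval_prec_iterates:
  "reval (RPrec g h) (n # xs) y \<Longrightarrow>
   \<exists>r. reval g xs (r 0) \<and> (\<forall>i<n. reval h (i # r i # xs) (r (Suc i))) \<and> r n = y"
proof (induction n arbitrary: y)
  case 0
  then show ?case by (auto elim!: reval_prec0E intro!: exI[of _ "\<lambda>_. y"])
next
  case (Suc n)
  then obtain z where z: "reval (RPrec g h) (n # xs) z" "reval h (n # z # xs) y"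
    by (auto elim: reval_precSE)
  then obtain r where "reval g xs (r 0)" "\<forall>i<n. reval h (i # r i # xs) (r (Suc i))" "r n = z"
    using Suc.IH by blast
  then show ?case
    using z by (intro exI[of _ "r(Suc n := y)"]) (auto simp: less_Suc_eq)
qed

text \<open>Arguments lie below \<open>b\<close> and everything below \<open>b\<close> is preserved,
  so they survive each sub-computation that writes from \<open>b\<close> upwards.\<close>

lemma wp_compile:
  "reval f (map s xs) y \<Longrightarrow> \<forall>x\<in>set xs. x < b \<Longrightarrow>
     wp (compile f xs b) (\<lambda>t. t b = y \<and> (\<forall>r<b. t r = s r)) s"
  "\<forall>i<length gs. reval (gs ! i) (map s xs) (z i) \<Longrightarrow> \<forall>x\<in>set xs. x < b \<Longrightarrow>
     wp (compiles gs xs b) (\<lambda>t. (\<forall>i<length gs. t (b + i) = z i) \<and> (\<forall>r<b. t r = s r)) s"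
proof (induction f xs b and gs xs b arbitrary: s y and s z rule: compile_compiles.induct)
  case (1 xs b)
  then show ?case by (auto elim!: reval_zeroE intro!: wp_asg)
next
  case (2 xs b)
  then show ?case by (auto elim!: reval_sucE intro!: wp_asg)
next
  case (3 i xs b)
  then show ?case by (auto elim!: reval_projE intro!: wp_asg)
next
  case (4 f gs xs b)
  define m where "m = Suc b + length gs"
  obtain zs where zs: "length zs = length gs" "\<forall>i<length gs. reval (gs ! i) (map s xs) (zs ! i)"
    "reval f zs y"
    using 4(3) by (auto elim: reval_compE)
  have "wp (compiles gs xs (Suc b))
     (\<lambda>t. (\<forall>i<length gs. t (Suc b + i) = zs ! i) \<and> (\<forall>r<Suc b. t r = s r)) s"
    using 4(1)[of s "(!) zs"] zs(2) 4(4) by (auto simp: less_SucI)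
  then have "wp (compiles gs xs (Suc b)) (wp (Seq (compile f [Suc b..<m] m) (Asg b (RReg m)))
     (\<lambda>t. t b = y \<and> (\<forall>r<b. t r = s r))) s"
  proof (rule wp_mono, goal_cases)
    case (1 t)
    have "map t [Suc b..<m] = zs"
      using 1 zs(1) by (intro nth_equalityI) (auto simp: m_def simp del: upt_Suc)
    then have "wp (compile f [Suc b..<m] m) (\<lambda>u. u m = y \<and> (\<forall>r<m. u r = t r)) t"
      using 4(2)[of t y, folded m_def] zs(3) by auto
    then show ?case
      by (intro wp_seq) (rule wp_mono, assumption, rule wp_asg, use 1 in \<open>auto simp: m_def\<close>)
  qed
  then show ?case by (auto simp: m_def intro: wp_seq)
next
  case (5 g h xs b)
  obtain x ys where xs: "xs = x # ys"
    using 5(3) by (cases xs) (auto elim: reval_precE)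
  define n where "n = s x"
  obtain r where r: "reval g (map s ys) (r 0)"
    "\<And>i. i < n \<Longrightarrow> reval h (i # r i # map s ys) (r (Suc i))" "r n = y"
    using reval_prec_iterates[of g h n "map s ys" y] 5(3) by (auto simp: xs n_def)
  \<comment> \<open>Register \<open>b\<close> accumulates and \<open>b + 1\<close> counts. As
    \<open>h\<close> reads both, its result is computed at \<open>b + 2\<close> and moved down
    afterwards.\<close>
  define I where "I i t \<longleftrightarrow> t b = r i \<and> t (b + 1) = i \<and> (\<forall>r<b. t r = s r)" for i t
  have xb: "x < b" "\<forall>x\<in>set ys. x < b" using 5(4) by (auto simp: xs)
  have body: "wp (Seq (compile h ((b + 1) # b # ys) (b + 2))
         (Seq (Asg b (RReg (b + 2))) (Asg (b + 1) (RSuc (b + 1))))) (I (Suc i)) t"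
    if i: "i < n" and t: "I i t" for i t
  proof -
    have "reval h (map t ((b + 1) # b # ys)) (r (Suc i))"
      using r(2)[OF i] t xb by (simp add: I_def cong: map_cong)
    then have "wp (compile h ((b + 1) # b # ys) (b + 2)) (\<lambda>u. u (b + 2) = r (Suc i) \<and> (\<forall>r<b + 2. u r = t r)) t"
      using xb by (intro 5(2)[of t, unfolded xs list.sel]) auto
    then show ?thesis
      by (intro wp_seq)
        (rule wp_mono, assumption, intro wp_seq wp_asg, use t in \<open>auto simp: I_def\<close>)
  qed
  have "wp (compile g ys b) (\<lambda>t. t b = r 0 \<and> (\<forall>r<b. t r = s r)) s"
    using 5(1)[of s "r 0"] r(1) xb by (simp add: xs)
  then show ?case
    unfolding compile.simps xs list.sel
  proof (intro wp_seq, elim wp_mono, intro wp_seq wp_asg, goal_cases)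
    case (1 t)
    show ?case
    proof (rule wp_until[where I = I and n = n])
      show "I 0 (t(b + 1 := rval t RZero))" using 1 by (auto simp: I_def)
      show "u (b + 1) \<noteq> u x \<and> wp (Seq (compile h ((b + 1) # b # ys) (b + 2))
         (Seq (Asg b (RReg (b + 2))) (Asg (b + 1) (RSuc (b + 1))))) (I (Suc i)) u"
        if "i < n" "I i u" for i u
        using body[OF that] that xb by (auto simp: I_def n_def)
      show "u (b + 1) = u x \<and> u b = y \<and> (\<forall>r<b. u r = s r)" if "I n u" for u
        using that xb r(3) by (auto simp: I_def n_def)
    qed
  qed
next
  case (6 f xs b)
  have y: "reval f (y # map s xs) 0" "\<And>z. z < y \<Longrightarrow> \<exists>v. reval f (z # map s xs) v \<and> 0 < v"
    using 6(3) by (auto elim: reval_mnE)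
  \<comment> \<open>Register \<open>b\<close> holds the candidate, \<open>b + 2\<close> the value of
    \<open>f\<close> there, and \<open>b + 1\<close> a constant 0 to compare with. The last conjunct
    turns the loop test into \<open>i = y\<close>.\<close>
  define I where "I i t \<longleftrightarrow> t b = i \<and> t (b + 1) = 0 \<and> (\<forall>r<b. t r = s r) \<and>
    (t (b + 2) = 0 \<longleftrightarrow> i = y)" for i t
  have f: "wp (compile f (b # xs) (b + 2)) (I i) t"
    if t: "i \<le> y" "t b = i" "t (b + 1) = 0" "\<forall>r<b. t r = s r" for i t
  proof -
    obtain v where v: "reval f (i # map s xs) v" "v = 0 \<longleftrightarrow> i = y"
      using y(1) y(2)[of i] t(1) by (cases "i = y") auto
    have "reval f (map t (b # xs)) v"
      using v(1) that 6(4) by (simp cong: map_cong)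
    then have "wp (compile f (b # xs) (b + 2)) (\<lambda>u. u (b + 2) = v \<and> (\<forall>r<b + 2. u r = t r)) t"
      using 6(4) by (intro 6(1)) auto
    then show ?thesis by (rule wp_mono) (use v(2) that in \<open>auto simp: I_def\<close>)
  qed
  show ?case
    unfolding compile.simps
  proof (intro wp_seq wp_asg, rule wp_mono[OF f[of 0]], goal_cases)
    case (5 t)
    show ?case
    proof (rule wp_until[where I = I and n = y])
      show "u (b + 2) \<noteq> u (b + 1) \<and>
        wp (Seq (Asg b (RSuc b)) (compile f (b # xs) (b + 2))) (I (Suc i)) u" if "i < y" "I i u" for i u
        using that by (intro conjI wp_seq wp_asg f) (auto simp: I_def)
    qed (use 5 in \<open>auto simp: I_def\<close>)
  qed auto
next
  case (7 xs b)
  then show ?case by (auto intro!: wp_skip)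
next
  case (8 g gs xs b)
  have "wp (compile g xs b) (\<lambda>t. t b = z 0 \<and> (\<forall>r<b. t r = s r)) s"
    using 8(1)[of s "z 0"] 8(3,4) by auto
  then show ?case
    unfolding compiles.simps
  proof (intro wp_seq, elim wp_mono, goal_cases)
    case (1 t)
    have "map t xs = map s xs" using 1 8(4) by auto
    then have "\<forall>i<length gs. reval (gs ! i) (map t xs) (z (Suc i))"
      using 8(3) by (fastforce simp del: map_eq_conv)
    then have "wp (compiles gs xs (Suc b))
       (\<lambda>u. (\<forall>i<length gs. u (Suc b + i) = z (Suc i)) \<and> (\<forall>r<Suc b. u r = t r)) t"
      using 8(4) by (intro 8(2)) (auto simp: less_SucI)
    then show ?case
    proof (rule wp_mono, goal_cases)
      case (1 u)
      have "u (b + i) = z i" if "i < Suc (length gs)" for i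
        using 1 \<open>t b = z 0 \<and> _\<close> that by (cases i) auto
      then show ?case using 1 \<open>t b = z 0 \<and> _\<close> by (auto simp: less_SucI)
    qed
  qed
qed

lemma finite_regs: "finite (regs c)"
proof -
  have "finite (rregs e)" for e by (cases e) auto
  then show ?thesis by (induction c) auto
qed

lemma reval_comp1: "reval g xs y \<Longrightarrow> reval f [y] z \<Longrightarrow> reval (RComp f [g]) xs z"
  by (rule reval.comp[of "[y]"]) auto

lemma reval_comp2:
  "reval g xs y \<Longrightarrow> reval h xs y' \<Longrightarrow> reval f [y, y'] z \<Longrightarrow> reval (RComp f [g, h]) xs z"
  by (rule reval.comp[of "[y, y']"]) (auto simp: less_Suc_eq)

lemma reval_proj0: "reval (RProj 0) (x # xs) x"
  using reval.proj[of 0 "x # xs"] by simp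

lemma reval_proj1: "reval (RProj 1) (x # y # xs) y"
  using reval.proj[of 1 "x # y # xs"] by simp

section \<open>Cantor pairing and repeated increments\<close>

definition radd :: recf where
  "radd = RPrec (RProj 0) (RComp RS [RProj 1])"

definition rtriangle :: recf where
  "rtriangle = RPrec RZ (RComp RS [RComp radd [RProj 1, RProj 0]])"

text \<open>This follows the closed form \<open>triangle (m + n) + m\<close> of
  \<open>prod_encode (m, n)\<close>.\<close>

definition rpair :: recf where
  "rpair = RComp radd [RComp rtriangle [radd], RProj 0]"

lemma reval_radd: "reval radd [m, n] (m + n)"
  unfolding radd_def
proof (induction m)
  case 0
  show ?case by (simp add: reval.prec0 reval_proj0)
next
  case (Suc m)
  have "reval (RComp RS [RProj 1]) [m, m + n, n] (Suc (m + n))"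
    using reval_comp1 reval_proj1 reval.suc by blast
  then show ?case using Suc reval.precS by simp
qed

lemma reval_rtriangle: "reval rtriangle [n] (triangle n)"
  unfolding rtriangle_def
proof (induction n)
  case 0
  show ?case by (simp add: reval.prec0 reval.zero)
next
  case (Suc n)
  have "reval (RComp RS [RComp radd [RProj 1, RProj 0]]) [n, triangle n] (Suc (triangle n + n))"
    by (rule reval_comp1[OF reval_comp2[OF reval_proj1 reval_proj0 reval_radd] reval.suc])
  then show ?case using Suc reval.precS by simp
qed

lemma reval_rpair: "reval rpair [m, n] (prod_encode (m, n))"
  unfolding rpair_def prod_encode_def
  using reval_comp2[OF reval_comp1[OF reval_radd reval_rtriangle] reval_proj0 reval_radd] by simp

lemma wp_rpair:
  assumes "p < b" "q < b"
  shows "wp (compile rpair [p, q] b) (\<lambda>t. t b = prod_encode (s p, s q) \<and> (\<forall>r<b. t r = s r)) s"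
  using assms reval_rpair by (intro wp_compile(1)) auto

primrec cpow :: "nat \<Rightarrow> com \<Rightarrow> com" where
  "cpow 0 c = Skip"
| "cpow (Suc m) c = Seq c (cpow m c)"

lemma regs_cpow: "regs (cpow m c) \<subseteq> regs c"
  by (induction m) auto

lemma wp_cpow_suc: "P (s(r := s r + m)) \<Longrightarrow> wp (cpow m (Asg r (RSuc r))) P s"
  by (induction m arbitrary: s) (auto intro!: wp_skip wp_seq wp_asg)

section \<open>A program that computes the code of the formula it is run by\<close>

definition pencs :: "nat list \<Rightarrow> nat \<Rightarrow> nat" where
  "pencs ks h = foldr (\<lambda>k h. prod_encode (k, h)) ks h"

lemma pencs_append: "pencs (ks @ ls) h = pencs ks (pencs ls h)"
  by (simp add: pencs_def)

lemma enc_mand: "enc_m (mand a c) = pencs [3, 2, enc_m (MNot a), 3] (enc_m c)"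
  by (simp add: mand_def pencs_def)

lemma enc_mconj: "\<exists>ks. \<forall>c. enc_m (mconj as c) = pencs ks (enc_m c)"
proof (induction as)
  case Nil
  show ?case by (rule exI[of _ "[]"]) (simp add: mconj_def pencs_def)
next
  case (Cons a as)
  then obtain ks where "\<forall>c. enc_m (mconj as c) = pencs ks (enc_m c)" by blast
  then show ?case
    by (intro exI[of _ "[3, 2, enc_m (MNot a), 3] @ ks"])
      (simp only: pencs_append, simp add: mconj_def enc_mand)
qed

text \<open>The continuation sits rightmost in every constructor involved, so its code is the
  innermost argument of nested pairings whose other arguments are constants.\<close>

lemma enc_tr_asg: "\<exists>ks. \<forall>C. enc_m (tr N (Asg b e) n C) = pencs ks (enc_m C)"
proof -
  obtain ks where ks: "\<forall>c. enc_m (mconj (masg N b e) c) = pencs ks (enc_m c)"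
    using enc_mconj by blast
  obtain d where d: "\<forall>C. enc_m (MNext (blocks N) C) = pencs [4, d] (enc_m C)"
    by (simp add: pencs_def)
  show ?thesis
    by (rule exI[of _ "ks @ [4, d]"]) (simp only: pencs_append tr.simps ks d simp_thms)
qed

lemma enc_tr_cpow:
  assumes "\<And>C. enc_m (tr N c n C) = pencs ks (enc_m C)"
  shows "enc_m (tr N (cpow m c) n C) = (pencs ks ^^ m) (enc_m C)"
  by (induction m) (simp_all add: assms)

text \<open>Register 1 accumulates the code, 3 holds the constant, and the pairing works from 4
  upwards; registers 0 and 2 are left to \<open>selfcode\<close>.\<close>

definition push :: "nat \<Rightarrow> com" where
  "push k = Seq (Asg 3 RZero) (Seq (cpow k (Asg 3 (RSuc 3)))
     (Seq (compile rpair [3, 1] 4) (Asg 1 (RReg 4))))"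

text \<open>The list is processed from its end, since the last constant is innermost in
  \<open>pencs\<close>.\<close>

primrec pushes :: "nat list \<Rightarrow> com" where
  "pushes [] = Skip"
| "pushes (k # ks) = Seq (pushes ks) (push k)"

text \<open>The number in register 0 has two roles, start value and number of loop rounds, so the
  program text does not depend on it.\<close>

definition selfcode :: "nat list \<Rightarrow> nat list \<Rightarrow> nat \<Rightarrow> com" where
  "selfcode ls ks m = Seq (Asg 1 (RReg 0)) (Seq (Asg 2 RZero)
     (Seq (Until 2 0 (Seq (pushes ls) (Asg 2 (RSuc 2)))) (Seq (pushes ks)
       (Seq (Asg 3 RZero) (Seq (cpow m (Asg 3 (RSuc 3))) (compile rpair [1, 3] 4))))))"

text \<open>The bound is uniform in the parameters of \<open>selfcode\<close>: the constants to be
  pushed depend on \<open>N\<close>, so \<open>N\<close> must be fixed before them.\<close>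

definition selfregs :: "nat set" where
  "selfregs = {..5} \<union> regs (compile rpair [3, 1] 4) \<union> regs (compile rpair [1, 3] 4)"

lemma regs_pushes: "regs (pushes ks) \<subseteq> selfregs"
  using regs_cpow[of _ "Asg 3 (RSuc 3)"]
  by (induction ks) (fastforce simp: push_def selfregs_def)+

lemma regs_selfcode: "regs (selfcode ls ks m) \<subseteq> selfregs"
  using regs_cpow[of m "Asg 3 (RSuc 3)"] regs_pushes[of ls] regs_pushes[of ks]
  unfolding selfcode_def by (auto simp: selfregs_def)

lemma wp_push: "wp (push k) (\<lambda>t. t 1 = prod_encode (k, s 1) \<and> t 0 = s 0 \<and> t 2 = s 2) s"
  unfolding push_def
  by (intro wp_seq wp_asg wp_cpow_suc, rule wp_mono[OF wp_rpair]) (auto intro!: wp_asg)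

lemma wp_pushes: "wp (pushes ks) (\<lambda>t. t 1 = pencs ks (s 1) \<and> t 0 = s 0 \<and> t 2 = s 2) s"
proof (induction ks)
  case Nil
  show ?case by (auto simp: pencs_def intro!: wp_skip)
next
  case (Cons k ks)
  have "wp (push k) (\<lambda>t. t 1 = pencs (k # ks) (s 1) \<and> t 0 = s 0 \<and> t 2 = s 2) u"
    if "u 1 = pencs ks (s 1) \<and> u 0 = s 0 \<and> u 2 = s 2" for u
    by (rule wp_mono[OF wp_push]) (use that in \<open>auto simp: pencs_def\<close>)
  then show ?case using wp_seq[OF wp_mono[OF Cons]] by simp
qed

lemma wp_selfcode:
  "wp (selfcode ls ks m) (\<lambda>t. t 4 = prod_encode (pencs ks ((pencs ls ^^ s 0) (s 0)), m)) s"
proof -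
  define I where "I i t \<longleftrightarrow> t 0 = s 0 \<and> t 2 = i \<and> t 1 = (pencs ls ^^ i) (s 0)"
    for i and t :: "nat \<Rightarrow> nat"
  have body: "wp (Seq (pushes ls) (Asg 2 (RSuc 2))) (I (Suc i)) t" if "I i t" for i t
    by (intro wp_seq, rule wp_mono[OF wp_pushes]) (use that in \<open>auto simp: I_def intro!: wp_asg\<close>)
  have fin: "wp (Seq (pushes ks) (Seq (Asg 3 RZero) (Seq (cpow m (Asg 3 (RSuc 3))) (compile rpair [1, 3] 4))))
    (\<lambda>t. t 4 = prod_encode (pencs ks ((pencs ls ^^ s 0) (s 0)), m)) t" if "I (s 0) t" for t
    by (intro wp_seq, rule wp_mono[OF wp_pushes], intro wp_seq wp_asg wp_cpow_suc, rule wp_mono[OF wp_rpair])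
      (use that in \<open>auto simp: I_def\<close>)
  show ?thesis
    unfolding selfcode_def
    by (intro wp_seq wp_asg, rule wp_until[where I = I and n = "s 0"])
      (use body fin in \<open>auto simp: I_def\<close>)
qed

section \<open>The reduction\<close>

definition hexs :: "nat list \<Rightarrow> hform \<Rightarrow> hform" where
  "hexs ps f = foldr HEx ps f"

lemma hsat_hexs:
  "hsat T Pi (hexs ps f) \<longleftrightarrow>
     (\<exists>Pi'. (\<forall>p\<in>set ps. Pi' p \<in> T) \<and> (\<forall>p. p \<notin> set ps \<longrightarrow> Pi' p = Pi p) \<and> hsat T Pi' f)"
proof (induction ps arbitrary: Pi)
  case Nil
  have "Pi' = Pi" if "\<forall>p. Pi' p = Pi p" for Pi' using that by auto
  then show ?case by (auto simp: hexs_def)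
next
  case (Cons q ps)
  have "hsat T Pi (hexs (q # ps) f) \<longleftrightarrow> (\<exists>t\<in>T. \<exists>Pi'. (\<forall>p\<in>set ps. Pi' p \<in> T) \<and>
      (\<forall>p. p \<notin> set ps \<longrightarrow> Pi' p = (Pi(q := t)) p) \<and> hsat T Pi' f)"
    using Cons by (simp add: hexs_def)
  also have "\<dots> \<longleftrightarrow> (\<exists>Pi'. (\<forall>p\<in>set (q # ps). Pi' p \<in> T) \<and>
      (\<forall>p. p \<notin> set (q # ps) \<longrightarrow> Pi' p = Pi p) \<and> hsat T Pi' f)"
    (is "?L \<longleftrightarrow> ?R")
  proof
    assume ?L
    then obtain t Pi' where "t \<in> T" "\<forall>p\<in>set ps. Pi' p \<in> T"
      "\<forall>p. p \<notin> set ps \<longrightarrow> Pi' p = (Pi(q := t)) p" "hsat T Pi' f" by blast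
    then show ?R by (intro exI[of _ Pi']) (metis fun_upd_apply set_ConsD list.set_intros)
  next
    assume ?R
    then obtain Pi' where "\<forall>p\<in>set (q # ps). Pi' p \<in> T"
      "\<forall>p. p \<notin> set (q # ps) \<longrightarrow> Pi' p = Pi p" "hsat T Pi' f" by blast
    then show ?L by (intro bexI[of _ "Pi' q"] exI[of _ Pi']) auto
  qed
  finally show ?case .
qed

lemma hok_hexs: "hok G (hexs ps f) \<longleftrightarrow> hok (G \<union> set ps) f"
  by (induction ps arbitrary: G) (auto simp: hexs_def)

lemma enc_hexs: "enc_h (hexs ps f) = pencs (concat (map (\<lambda>p. [0, p]) ps)) (enc_h f)"
  by (induction ps) (auto simp: hexs_def pencs_def)

text \<open>In this complete graph on a marked and an unmarked state every placement of marks is a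
  trace, so one structure serves for all formulae.\<close>

definition allmarks :: kripke where
  "allmarks = Kripke 2 [0, 1] [(0, 0), (0, 1), (1, 0), (1, 1)] [[0], []]"

lemma kwf_allmarks: "kwf allmarks"
  by (simp add: allmarks_def)

lemma strace_allmarks: "strace u \<in> ktraces allmarks"
proof -
  let ?r = "\<lambda>i. if \<exists>j. i = mpos u (Suc j) then 0 else 1 :: nat"
  have "strace u = (\<lambda>i. set ([[0], []] ! ?r i))"
    by (auto simp: strace_def fun_eq_iff)
  then show ?thesis
    unfolding allmarks_def ktraces.simps by (intro CollectI exI[of _ ?r] conjI) auto
qed

definition halts0 :: "nat \<Rightarrow> com \<Rightarrow> nat \<Rightarrow> hform" where
  "halts0 N c b = hexs [0..<2 * N] (HBody (mconj (map (\<lambda>r. mzero (2 * r)) [0..<N])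
     (tr N c 0 (mzero (2 * b)))))"

lemma hclosed_halts0:
  assumes "regs c \<subseteq> {..<N}" "b < N"
  shows "hclosed (halts0 N c b)"
proof -
  have "mok {..<2 * N} (tr N c 0 (mzero (2 * b)))"
    using assms by (intro mok_tr) auto
  moreover have "mocc True (tr N c 0 (mzero (2 * b))) = {}"
    using mocc_tr[of True N c 0 "mzero (2 * b)"] by simp
  ultimately show ?thesis
    by (simp add: hclosed_def halts0_def hok_hexs atLeast0LessThan)
qed

text \<open>Termination is assumed, so soundness and completeness speak about the same run and
  combine to an equivalence.\<close>

lemma models_halts0:
  assumes c: "exec c (\<lambda>_. 0) t" "regs c \<subseteq> {..<N}" and b: "b < N"
  shows "models (ktraces allmarks) (halts0 N c b) \<longleftrightarrow> t b = 0"
proof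
  assume "models (ktraces allmarks) (halts0 N c b)"
  then obtain Pi where zero: "\<forall>r\<in>{0..<N}. (\<lambda>_. 0) \<in> msem Pi (\<lambda>_. {}) (mzero (2 * r))"
    and tr: "(\<lambda>_. 0) \<in> msem Pi (\<lambda>_. {}) (tr N c 0 (mzero (2 * b)))"
    by (auto simp: models_def halts0_def hsat_hexs)
  have "encodes N Pi (\<lambda>_. 0) (\<lambda>_. 0)"
    using zero by (simp add: encodes_def msem_mzero)
  then obtain v where "encodes N Pi v t" "v \<in> msem Pi (\<lambda>_. {}) (mzero (2 * b))"
    using tr_sound[OF c _ _ tr] by auto
  then show "t b = 0"
    using b blk_unique by (auto simp: encodes_def msem_mzero)
next
  assume t: "t b = 0"
  obtain l where l: "((\<lambda>_. 0) # l) ! length l = t" "guides c (\<lambda>_. 0) l"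
    using exec_guides[OF c(1)] by blast
  \<comment> \<open>The run is finite but traces are infinite, so the last state is repeated
    forever.\<close>
  define z where "z i = ((\<lambda>_. 0) # l) ! min i (length l)" for i
  \<comment> \<open>Outside the quantified variables \<open>Pi\<close> has to agree with the empty
    assignment from which \<open>models\<close> starts.\<close>
  define Pi where "Pi p = (if p < 2 * N then strace (col z p) else (\<lambda>_. {}))" for p
  have init: "onseq N Pi z (\<lambda>_. 0) 0"
    by (simp add: onseq_def Pi_def)
  have "(\<lambda>_. 0) \<in> msem Pi (\<lambda>_. {}) (tr N c 0 (mzero (2 * b)))"
  proof (rule guidesD[OF l(2) c(2) _ _ _ init])
    fix v assume "onseq N Pi z v (0 + length l)"
    from onseq_at[OF this] have "encodes N Pi v t" using l(1) by (simp add: z_def)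
    then show "v \<in> msem Pi (\<lambda>_. {}) (mzero (2 * b))"
      using b t by (auto simp: encodes_def msem_mzero)
  qed (auto simp: z_def)
  moreover have "(\<lambda>_. 0) \<in> msem Pi (\<lambda>_. {}) (mzero (2 * r))" if "r < N" for r
    using onseq_at[OF init] that by (auto simp: encodes_def msem_mzero z_def)
  ultimately show "models (ktraces allmarks) (halts0 N c b)"
    unfolding models_def halts0_def hsat_hexs
    by (intro exI[of _ Pi]) (auto simp: Pi_def strace_allmarks)
qed

theorem theorem4p1:
  shows "\<not> (\<exists>f. \<forall>phi K. hclosed phi \<and> kwf K \<longrightarrow>
            reval f [prod_encode (enc_h phi, enc_k K)]
                  (if models (ktraces K) phi then 1 else 0))"
proof
  assume "\<exists>f. \<forall>phi K. hclosed phi \<and> kwf K \<longrightarrow>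
            reval f [prod_encode (enc_h phi, enc_k K)]
                  (if models (ktraces K) phi then 1 else 0)"
  then obtain f where f: "\<And>phi K. hclosed phi \<Longrightarrow> kwf K \<Longrightarrow>
      reval f [prod_encode (enc_h phi, enc_k K)] (if models (ktraces K) phi then 1 else 0)"
    by blast
  have "finite (selfregs \<union> regs (compile f [4] 5))"
    by (simp add: selfregs_def finite_regs)
  then obtain N where N: "selfregs \<union> regs (compile f [4] 5) \<subseteq> {..<N}"
    by (auto simp: finite_nat_set_iff_bounded)
  obtain ls where ls: "\<And>C. enc_m (tr N (Asg 0 (RSuc 0)) 0 C) = pencs ls (enc_m C)"
    using enc_tr_asg by blast
  obtain ks0 where ks0: "\<And>C. enc_m (mconj (map (\<lambda>r. mzero (2 * r)) [0..<N]) C) = pencs ks0 (enc_m C)"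
    using enc_mconj by blast
  define ks where "ks = concat (map (\<lambda>p. [0, p]) [0..<2 * N]) @ [2] @ ks0"
  define d where "d = Seq (selfcode ls ks (enc_k allmarks)) (compile f [4] 5)"
  \<comment> \<open>Only the part behind the increments is encoded here. Since \<open>d\<close> does
    not mention \<open>x\<close>, loading \<open>x\<close> in front of it is not circular.\<close>
  define x where "x = enc_m (tr N d 0 (mzero (2 * 5)))"
  define c where "c = Seq (cpow x (Asg 0 (RSuc 0))) d"
  define phi where "phi = halts0 N c 5"
  define y where "y = (if models (ktraces allmarks) phi then 1 else 0 :: nat)"
  have "5 < N" "0 < N" using N by (auto simp: selfregs_def)
  have regs: "regs c \<subseteq> {..<N}"
    using N \<open>0 < N\<close> regs_selfcode[of ls ks "enc_k allmarks"] regs_cpow[of x "Asg 0 (RSuc 0)"]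
    unfolding c_def d_def by auto
  \<comment> \<open>Quantifiers, the tag 2 of \<open>HBody\<close> and the initial zero tests
    contribute \<open>ks\<close>, each of the \<open>x\<close> increments contributes
    \<open>ls\<close>, and the remaining body has code \<open>x\<close>.\<close>
  have code: "enc_h phi = pencs ks ((pencs ls ^^ x) x)"
    unfolding phi_def halts0_def enc_hexs ks_def pencs_append c_def
    by (simp add: enc_tr_cpow[OF ls] ks0 x_def) (simp add: pencs_def)
  have "reval f [prod_encode (enc_h phi, enc_k allmarks)] y"
    unfolding y_def phi_def using f hclosed_halts0[OF regs \<open>5 < N\<close>] kwf_allmarks by blast
  then have "wp (compile f [4] 5) (\<lambda>t. t 5 = y) t"
    if "t 4 = prod_encode (pencs ks ((pencs ls ^^ x) x), enc_k allmarks)" for t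
    by (intro wp_mono[OF wp_compile(1)[where s = t and xs = "[4]" and y = y]]) (use that code in auto)
  then have "wp d (\<lambda>t. t 5 = y) ((\<lambda>_. 0)(0 := x))"
    unfolding d_def using wp_selfcode[of ls ks "enc_k allmarks" "(\<lambda>_. 0)(0 := x)"]
    by (auto intro!: wp_seq elim!: wp_mono)
  then have "wp c (\<lambda>t. t 5 = y) (\<lambda>_. 0)"
    unfolding c_def by (intro wp_seq wp_cpow_suc) simp
  then obtain t where "exec c (\<lambda>_. 0) t" "t 5 = y"
    unfolding wp_def by blast
  \<comment> \<open>Register 5 ends with the verdict \<open>y\<close>, so the formula holds iff the
    verdict is negative, against the definition of \<open>y\<close>.\<close>
  then have "models (ktraces allmarks) phi \<longleftrightarrow> y = 0"
    unfolding phi_def using models_halts0[OF _ regs \<open>5 < N\<close>] by metis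
  then show False by (simp add: y_def split: if_splits)
qed

end
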